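(* Let $X$ be a set and let $\Omega$ be a commutative semigroup. Let $\mathbf{k}\mathcal{T}(X,\Omega)$ be the free $\mathbf{k}$-module on the set $\mathcal{T}(X,\Omega)$ of $X$-decorated $\Omega$-typed rooted trees, with the operations $\rhd_\omega$ ($\omega\in\Omega$) defined on trees $S,T$ by $S\rhd_\omega T:=\sum_{v\in V(T)} S\xrightarrow[v]{\omega}T$ and extended bilinearly. Then $\bigl(\mathbf{k}\mathcal{T}(X,\Omega),(\rhd_\omega)_{\omega\in\Omega}\bigr)$ is a (left) pre-Lie family algebra.
   Context: $\mathbf{k}$ is a unitary commutative ring. (Left) pre-Lie family algebra (over a commutative semigroup $\Omega$): a $\mathbf{k}$-module $A$ with bilinear operations $\rhd_\omega:A\times A\to A$, $\omega\in\Omega$, such that for all $x,y,z\in A$ and $\alpha,\beta\in\Omega$: $x\rhd_\alpha(y\rhd_\beta z)-(x\rhd_\alpha y)\rhd_{\alpha\beta}z=y\rhd_\beta(x\rhd_\alpha z)-(y\rhd_\beta x)\rhd_{\beta\alpha}z$. An $X$-decorated $\Omega$-typed rooted tree is a (finite, nonempty, non-planar) rooted tree $T$ together with a map $\mathrm{dec}:V(T)\to X$ on its set of vertices and a map $\mathrm{type}:E(T)\to\Omega$ on its set of edges; trees are considered up to isomorphism of rooted trees preserving decorations and types. $\mathcal{T}(X,\Omega)$ is the set of all of them. For trees $S,T$, a vertex $v$ of $T$ and $\omega\in\Omega$, the tree $S\xrightarrow[v]{\omega}T$ is obtained as follows: $S$ is grafted on $T$ at $v$ by adding a new edge of type $\omega$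 between the root of $S$ and $v$ (the root of the result is the root of $T$); each edge of $T$ below $v$ (i.e. on the path from $v$ to the root of $T$) has its type multiplied by $\omega$; all other edges keep their types; decorations are unchanged. *)

theory Defs
  imports HOL.Modules "HOL-Library.Poly_Mapping"
begin

text \<open>
  Finite rooted trees, given by a vertex set, a root and the set of edges, each written as a pair
  (child, parent), i.e. oriented towards the root. The vertices are natural numbers; since trees
  are considered up to isomorphism below and are finite, this is no restriction. The values of
  \<open>dec\<close> outside \<open>verts\<close> and of \<open>etype\<close> outside \<open>edges\<close> are junk, ignored by isomorphisms.
\<close>

record ('x, 'w) typed_graph =
  verts :: "nat set"
  root :: nat
  edges :: "(nat \<times> nat) set"
  dec :: "nat \<Rightarrow> 'x"
  etype :: "nat \<times> nat \<Rightarrow> 'w"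

definition rooted_tree :: "('x, 'w) typed_graph \<Rightarrow> bool" where
  "rooted_tree T \<longleftrightarrow>
     finite (verts T) \<and> root T \<in> verts T \<and> edges T \<subseteq> verts T \<times> verts T \<and>
     (\<forall>u. (root T, u) \<notin> edges T) \<and>
     (\<forall>v \<in> verts T - {root T}. \<exists>!u. (v, u) \<in> edges T) \<and>
     (\<forall>v \<in> verts T. (v, root T) \<in> (edges T)\<^sup>*)"

definition is_iso :: "(nat \<Rightarrow> nat) \<Rightarrow> ('x, 'w) typed_graph \<Rightarrow> ('x, 'w) typed_graph \<Rightarrow> bool" where
  "is_iso f S T \<longleftrightarrow>
     bij_betw f (verts S) (verts T) \<and> f (root S) = root T \<and>
     (\<forall>u \<in> verts S. \<forall>v \<in> verts S. (u, v) \<in> edges S \<longleftrightarrow> (f u, f v) \<in> edges T) \<and>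
     (\<forall>v \<in> verts S. dec T (f v) = dec S v) \<and>
     (\<forall>(u, v) \<in> edges S. etype T (f u, f v) = etype S (u, v))"

definition tree_iso :: "('x, 'w) typed_graph \<Rightarrow> ('x, 'w) typed_graph \<Rightarrow> bool" where
  "tree_iso S T \<longleftrightarrow> rooted_tree S \<and> rooted_tree T \<and> (\<exists>f. is_iso f S T)"

lemma is_iso_id: "is_iso id T T"
  by (auto simp: is_iso_def)

lemma is_iso_comp:
  assumes "rooted_tree S" "is_iso f S T" "is_iso g T U"
  shows "is_iso (g \<circ> f) S U"
proof -
  have f: "f v \<in> verts T" if "v \<in> verts S" for v
    using assms(2) that by (auto simp: is_iso_def bij_betw_def)
  have e: "u \<in> verts S" "v \<in> verts S" if "(u, v) \<in> edges S" for u v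
    using assms(1) that by (auto simp: rooted_tree_def)
  have fe: "(f u, f v) \<in> edges T" if "(u, v) \<in> edges S" for u v
    using assms(2) e[OF that] that by (auto simp: is_iso_def)
  have "bij_betw (g \<circ> f) (verts S) (verts U)"
    using assms(2,3) bij_betw_trans by (auto simp: is_iso_def)
  moreover have "etype U (g (f u), g (f v)) = etype S (u, v)" if "(u, v) \<in> edges S" for u v
    using assms(2,3) that fe[OF that] by (fastforce simp: is_iso_def)
  ultimately show ?thesis
    using assms(2,3) f by (auto simp: is_iso_def)
qed

lemma is_iso_inv:
  assumes "rooted_tree S" "rooted_tree T" "is_iso f S T"
  shows "is_iso (the_inv_into (verts S) f) T S"
proof -
  define g where "g = the_inv_into (verts S) f"
  have b: "bij_betw f (verts S) (verts T)" using assms by (simp add: is_iso_def)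
  have bg: "bij_betw g (verts T) (verts S)"
    unfolding g_def using b by (rule bij_betw_the_inv_into)
  have fg: "f (g v) = v" if "v \<in> verts T" for v
    unfolding g_def using b that by (simp add: f_the_inv_into_f_bij_betw)
  have gV: "g v \<in> verts S" if "v \<in> verts T" for v
    using bg that by (auto simp: bij_betw_def)
  have gf: "g (f v) = v" if "v \<in> verts S" for v
    unfolding g_def using b that by (simp add: bij_betw_def the_inv_into_f_f)
  have r: "root S \<in> verts S" "f (root S) = root T"
    using assms by (auto simp: rooted_tree_def is_iso_def)
  have e: "u \<in> verts T" "v \<in> verts T" if "(u, v) \<in> edges T" for u v
    using assms(2) that by (auto simp: rooted_tree_def)
  have ed: "(u, v) \<in> edges T \<longleftrightarrow> (g u, g v) \<in> edges S" if "u \<in> verts T" "v \<in> verts T" for u v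
    using assms(3) gV[OF that(1)] gV[OF that(2)] fg[OF that(1)] fg[OF that(2)]
    by (simp add: is_iso_def)
  have "etype S (g u, g v) = etype T (u, v)" if "(u, v) \<in> edges T" for u v
  proof -
    have "(g u, g v) \<in> edges S" using ed e[OF that] that by blast
    then have "etype T (f (g u), f (g v)) = etype S (g u, g v)"
      using assms(3) by (auto simp: is_iso_def)
    then show ?thesis using fg e[OF that] by simp
  qed
  moreover have "dec S (g v) = dec T v" if "v \<in> verts T" for v
    using assms(3) gV[OF that] fg[OF that] by (fastforce simp: is_iso_def)
  moreover have "g (root T) = root S" using gf r by metis
  ultimately show ?thesis
    using bg ed unfolding g_def[symmetric] by (auto simp: is_iso_def)
qed

lemma part_equivp_tree_iso: "part_equivp tree_iso"
proof (rule part_equivpI)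
  let ?T = "\<lparr>verts = {0}, root = 0, edges = {}, dec = \<lambda>_. undefined, etype = \<lambda>_. undefined\<rparr>
    :: ('x, 'w) typed_graph"
  have "tree_iso ?T ?T"
    using is_iso_id by (auto simp: tree_iso_def rooted_tree_def)
  then show "\<exists>T :: ('x, 'w) typed_graph. tree_iso T T" by blast
  show "symp (tree_iso :: ('x, 'w) typed_graph \<Rightarrow> _)"
    by (rule sympI) (auto simp: tree_iso_def dest: is_iso_inv)
  show "transp (tree_iso :: ('x, 'w) typed_graph \<Rightarrow> _)"
    by (rule transpI) (auto simp: tree_iso_def dest: is_iso_comp)
qed

text \<open>The set \<open>\<T>(X, \<Omega>)\<close> of isomorphism classes, with \<open>X\<close> and \<open>\<Omega>\<close> the types \<open>'x\<close> and \<open>'w\<close>.\<close>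

quotient_type ('x, 'w) tree = "('x, 'w) typed_graph" / partial: tree_iso
  by (rule part_equivp_tree_iso)

text \<open>
  Grafting of \<open>S\<close> on \<open>T\<close> at \<open>v\<close>. The disjoint union of the vertex sets is realised in \<open>nat\<close> by
  renaming the vertices of \<open>S\<close> to even and those of \<open>T\<close> to odd numbers. An edge \<open>(a, b)\<close> of \<open>T\<close>
  is on the path from \<open>v\<close> to the root iff its child \<open>a\<close> can be reached from \<open>v\<close>.
\<close>

definition inS :: "nat \<Rightarrow> nat" where "inS n = 2 * n"
definition inT :: "nat \<Rightarrow> nat" where "inT n = 2 * n + 1"

definition edges_below :: "('x, 'w) typed_graph \<Rightarrow> nat \<Rightarrow> (nat \<times> nat) set" where
  "edges_below T v = {(a, b) \<in> edges T. (v, a) \<in> (edges T)\<^sup>*}"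

definition graft ::
  "'w::ab_semigroup_mult \<Rightarrow> ('x, 'w) typed_graph \<Rightarrow> nat \<Rightarrow> ('x, 'w) typed_graph \<Rightarrow> ('x, 'w) typed_graph"
where
  "graft \<omega> S v T =
     \<lparr>verts = inS ` verts S \<union> inT ` verts T,
      root = inT (root T),
      edges = map_prod inS inS ` edges S \<union> map_prod inT inT ` edges T \<union> {(inS (root S), inT v)},
      dec = (\<lambda>n. if even n then dec S (n div 2) else dec T (n div 2)),
      etype = (\<lambda>(m, n).
        if even m \<and> even n then etype S (m div 2, n div 2)
        else if odd m \<and> odd n then
          (let e = (m div 2, n div 2) in if e \<in> edges_below T v then etype T e * \<omega> else etype T e)
        else \<omega>)\<rparr>"

lemma inj_in: "inS m = inS n \<longleftrightarrow> m = n" "inT m = inT n \<longleftrightarrow> m = n" "inS m \<noteq> inT n" "inT n \<noteq> inS m"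
  unfolding inS_def inT_def by presburger+

lemma parity_in: "even (inS n)" "odd (inT n)" "inS n div 2 = n" "inT n div 2 = n"
  by (auto simp: inS_def inT_def)

lemma graft_sel:
  "verts (graft \<omega> S v T) = inS ` verts S \<union> inT ` verts T"
  "root (graft \<omega> S v T) = inT (root T)"
  "edges (graft \<omega> S v T) =
     map_prod inS inS ` edges S \<union> map_prod inT inT ` edges T \<union> {(inS (root S), inT v)}"
  "dec (graft \<omega> S v T) (inS n) = dec S n"
  "dec (graft \<omega> S v T) (inT n) = dec T n"
  "etype (graft \<omega> S v T) (inS m, inS n) = etype S (m, n)"
  "etype (graft \<omega> S v T) (inT m, inT n) =
     (if (m, n) \<in> edges_below T v then etype T (m, n) * \<omega> else etype T (m, n))"
  "etype (graft \<omega> S v T) (inS m, inT n) = \<omega>"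
  by (simp_all add: graft_def parity_in)

lemma graft_edges:
  "(inS m, inS n) \<in> edges (graft \<omega> S v T) \<longleftrightarrow> (m, n) \<in> edges S"
  "(inT m, inT n) \<in> edges (graft \<omega> S v T) \<longleftrightarrow> (m, n) \<in> edges T"
  "(inS m, inT n) \<in> edges (graft \<omega> S v T) \<longleftrightarrow> m = root S \<and> n = v"
  "(inT m, inS n) \<notin> edges (graft \<omega> S v T)"
  by (force simp: graft_sel inj_in)+

lemma rooted_tree_graft:
  assumes S: "rooted_tree S" and T: "rooted_tree T" and v: "v \<in> verts T"
  shows "rooted_tree (graft \<omega> S v T)"
proof -
  let ?G = "graft \<omega> S v T"
  have rS: "(inS a, inS b) \<in> (edges ?G)\<^sup>*" if "(a, b) \<in> (edges S)\<^sup>*" for a b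
    using that by induction (auto simp: graft_edges intro: rtrancl_into_rtrancl)
  have rT: "(inT a, inT b) \<in> (edges ?G)\<^sup>*" if "(a, b) \<in> (edges T)\<^sup>*" for a b
    using that by induction (auto simp: graft_edges intro: rtrancl_into_rtrancl)
  have 1: "(inT a, root ?G) \<in> (edges ?G)\<^sup>*" if "a \<in> verts T" for a
    using T that by (auto simp: rooted_tree_def graft_sel(2) intro: rT)
  have 2: "(inS a, root ?G) \<in> (edges ?G)\<^sup>*" if "a \<in> verts S" for a
  proof -
    have "(inS a, inS (root S)) \<in> (edges ?G)\<^sup>*"
      using S that by (auto simp: rooted_tree_def intro: rS)
    moreover have "(inS (root S), inT v) \<in> edges ?G" by (simp add: graft_edges)
    ultimately show ?thesis using 1[OF v] by (meson rtrancl.rtrancl_into_rtrancl rtrancl_trans)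
  qed
  have uT: "\<exists>!u. (a, u) \<in> edges T" if "a \<in> verts T - {root T}" for a
    using T that by (simp add: rooted_tree_def)
  have uS: "\<exists>!u. (a, u) \<in> edges S" if "a \<in> verts S - {root S}" for a
    using S that by (simp add: rooted_tree_def)
  have 3: "\<exists>!u. (inT a, u) \<in> edges ?G" if a: "a \<in> verts T - {root T}" for a
  proof -
    obtain b where b: "(a, b) \<in> edges T" "\<And>c. (a, c) \<in> edges T \<Longrightarrow> c = b"
      using uT[OF a] by (elim ex1E) blast
    show ?thesis
    proof (rule ex1I)
      show "(inT a, inT b) \<in> edges ?G" using b(1) by (simp add: graft_edges)
      show "u = inT b" if "(inT a, u) \<in> edges ?G" for u
        using that b(2) by (auto simp: graft_sel(3) inj_in)
    qed
  qed
  have 4: "\<exists>!u. (inS a, u) \<in> edges ?G" if a: "a \<in> verts S" for a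
  proof (cases "a = root S")
    case True
    have "(root S, u) \<notin> edges S" for u using S by (simp add: rooted_tree_def)
    then have "(inS a, u) \<in> edges ?G \<longleftrightarrow> u = inT v" for u
      using True by (auto simp: graft_sel(3) inj_in)
    then show ?thesis by simp
  next
    case False
    with a have aS: "a \<in> verts S - {root S}" by simp
    obtain b where b: "(a, b) \<in> edges S" "\<And>c. (a, c) \<in> edges S \<Longrightarrow> c = b"
      using uS[OF aS] by (elim ex1E) blast
    show ?thesis
    proof (rule ex1I)
      show "(inS a, inS b) \<in> edges ?G" using b(1) by (simp add: graft_edges)
      show "u = inS b" if "(inS a, u) \<in> edges ?G" for u
        using that b(2) False by (auto simp: graft_sel(3) inj_in)
    qed
  qed
  have 5: "edges ?G \<subseteq> verts ?G \<times> verts ?G"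
    using S T v by (auto simp: graft_sel rooted_tree_def)
  have 6: "(root ?G, u) \<notin> edges ?G" for u
    using T by (auto simp: graft_sel rooted_tree_def inj_in)
  have 7: "finite (verts ?G)" "root ?G \<in> verts ?G"
    using S T by (auto simp: graft_sel rooted_tree_def)
  have 8: "(x, root ?G) \<in> (edges ?G)\<^sup>*" if "x \<in> verts ?G" for x
    using that 1 2 by (auto simp: graft_sel(1))
  have 9: "\<exists>!u. (x, u) \<in> edges ?G" if "x \<in> verts ?G - {root ?G}" for x
  proof -
    from that consider a where "x = inT a" "a \<in> verts T - {root T}" | a where "x = inS a" "a \<in> verts S"
      by (auto simp: graft_sel(1,2) inj_in)
    then show ?thesis by cases (simp_all only: 3 4)
  qed
  show ?thesis
    unfolding rooted_tree_def by (intro conjI ballI allI 5 6 7 8 9)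
qed

lemma is_iso_rtrancl:
  assumes "rooted_tree S" "is_iso f S T" "(a, b) \<in> (edges S)\<^sup>*"
  shows "(f a, f b) \<in> (edges T)\<^sup>*"
  using assms(3)
proof induction
  case (step b c)
  then have "(f b, f c) \<in> edges T" using assms(1,2) by (auto simp: is_iso_def rooted_tree_def)
  with step show ?case by (meson rtrancl.rtrancl_into_rtrancl)
qed simp

lemma tree_iso_graft:
  assumes S: "rooted_tree S" "rooted_tree S'" "is_iso g S S'"
    and T: "rooted_tree T" "rooted_tree T'" "is_iso f T T'" and v: "v \<in> verts T"
  shows "tree_iso (graft \<omega> S v T) (graft \<omega> S' (f v) T')"
proof -
  let ?G = "graft \<omega> S v T" and ?G' = "graft \<omega> S' (f v) T'"
  have fv: "f a \<in> verts T'" if "a \<in> verts T" for a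
    using T(3) that by (auto simp: is_iso_def bij_betw_def)
  have gv: "g a \<in> verts S'" if "a \<in> verts S" for a
    using S(3) that by (auto simp: is_iso_def bij_betw_def)
  have f_eq: "f a = f b \<longleftrightarrow> a = b" if "a \<in> verts T" "b \<in> verts T" for a b
    using T(3) that by (auto simp: is_iso_def bij_betw_def inj_on_def)
  have g_eq: "g a = g b \<longleftrightarrow> a = b" if "a \<in> verts S" "b \<in> verts S" for a b
    using S(3) that by (auto simp: is_iso_def bij_betw_def inj_on_def)
  have eT: "a \<in> verts T \<and> b \<in> verts T" if "(a, b) \<in> edges T" for a b
    using T(1) that by (auto simp: rooted_tree_def)
  have eS: "a \<in> verts S \<and> b \<in> verts S" if "(a, b) \<in> edges S" for a b
    using S(1) that by (auto simp: rooted_tree_def)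
  have fe: "(f a, f b) \<in> edges T' \<longleftrightarrow> (a, b) \<in> edges T" if "a \<in> verts T" "b \<in> verts T" for a b
    using T(3) that by (auto simp: is_iso_def)
  have ge: "(g a, g b) \<in> edges S' \<longleftrightarrow> (a, b) \<in> edges S" if "a \<in> verts S" "b \<in> verts S" for a b
    using S(3) that by (auto simp: is_iso_def)
  have ft: "etype T' (f a, f b) = etype T (a, b)" if "(a, b) \<in> edges T" for a b
    using T(3) that by (auto simp: is_iso_def)
  have gt: "etype S' (g a, g b) = etype S (a, b)" if "(a, b) \<in> edges S" for a b
    using S(3) that by (auto simp: is_iso_def)
  have fr: "f (root T) = root T'" using T(3) by (simp add: is_iso_def)
  have gr: "g (root S) = root S'" using S(3) by (simp add: is_iso_def)
  have rS: "root S \<in> verts S" using S(1) by (simp add: rooted_tree_def)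
  have im: "f ` verts T = verts T'" "g ` verts S = verts S'"
    using S(3) T(3) by (auto simp: is_iso_def bij_betw_def)
  have fd: "dec T' (f a) = dec T a" if "a \<in> verts T" for a
    using T(3) that by (auto simp: is_iso_def)
  have gd: "dec S' (g a) = dec S a" if "a \<in> verts S" for a
    using S(3) that by (auto simp: is_iso_def)
  have reach: "(f a, f b) \<in> (edges T')\<^sup>* \<longleftrightarrow> (a, b) \<in> (edges T)\<^sup>*"
    if ab: "a \<in> verts T" "b \<in> verts T" for a b
  proof
    let ?h = "the_inv_into (verts T) f"
    have h: "?h (f a) = a" if "a \<in> verts T" for a
      using T(3) that by (auto simp: is_iso_def bij_betw_def the_inv_into_f_f)
    assume "(f a, f b) \<in> (edges T')\<^sup>*"
    from is_iso_rtrancl[OF T(2) is_iso_inv[OF T] this] show "(a, b) \<in> (edges T)\<^sup>*"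
      using h ab by simp
  qed (rule is_iso_rtrancl[OF T(1,3)])
  have below: "(f a, f b) \<in> edges_below T' (f v) \<longleftrightarrow> (a, b) \<in> edges_below T v"
    if "a \<in> verts T" "b \<in> verts T" for a b
    using that fe reach v by (simp add: edges_below_def)
  define h where "h n = (if even n then inS (g (n div 2)) else inT (f (n div 2)))" for n
  have h: "h (inS n) = inS (g n)" "h (inT n) = inT (f n)" for n
    by (simp_all add: h_def parity_in)
  have "is_iso h ?G ?G'"
    unfolding is_iso_def
  proof (intro conjI)
    show "bij_betw h (verts ?G) (verts ?G')"
      unfolding bij_betw_def
    proof
      show "inj_on h (verts ?G)"
        by (rule inj_onI) (auto simp: graft_sel(1) h inj_in f_eq g_eq)
      show "h ` verts ?G = verts ?G'"
        by (simp add: graft_sel(1) image_Un image_image h flip: im)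
    qed
    show "h (root ?G) = root ?G'" by (simp add: graft_sel h fr)
    show "\<forall>a \<in> verts ?G. \<forall>b \<in> verts ?G. (a, b) \<in> edges ?G \<longleftrightarrow> (h a, h b) \<in> edges ?G'"
      using v rS by (auto simp: graft_sel(1) h graft_edges fe ge f_eq g_eq simp flip: gr)
    show "\<forall>a \<in> verts ?G. dec ?G' (h a) = dec ?G a"
      by (auto simp: graft_sel(1,4,5) h fd gd)
    show "\<forall>(a, b) \<in> edges ?G. etype ?G' (h a, h b) = etype ?G (a, b)"
      using eT eS by (auto simp: graft_sel(3,6-8) h gt ft below)
  qed
  then show ?thesis
    using rooted_tree_graft[OF S(1) T(1) v] rooted_tree_graft[OF S(2) T(2) fv[OF v]]
    by (auto simp: tree_iso_def)
qed

text \<open>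
  The free \<open>k\<close>-module on a type \<open>'a\<close> is the type \<open>'a \<Rightarrow>\<^sub>0 'k\<close> of finitely supported functions,
  with basis \<open>Poly_Mapping.single t 1\<close>.
\<close>

definition scale :: "'k::comm_ring_1 \<Rightarrow> ('a \<Rightarrow>\<^sub>0 'k) \<Rightarrow> ('a \<Rightarrow>\<^sub>0 'k)" where
  "scale c p = Poly_Mapping.map ((*) c) p"

lift_definition tree_rhd ::
  "'w::ab_semigroup_mult \<Rightarrow> ('x, 'w) tree \<Rightarrow> ('x, 'w) tree \<Rightarrow> (('x, 'w) tree \<Rightarrow>\<^sub>0 'k::comm_ring_1)"
  is "\<lambda>\<omega> S T. \<Sum>v \<in> verts T. Poly_Mapping.single (abs_tree (graft \<omega> S v T)) 1"
proof -
  fix \<omega> :: 'w and S S' T T' :: "('x, 'w) typed_graph"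
  assume "tree_iso S S'" "tree_iso T T'"
  then obtain g f where S: "rooted_tree S" "rooted_tree S'" "is_iso g S S'"
    and T: "rooted_tree T" "rooted_tree T'" "is_iso f T T'"
    by (auto simp: tree_iso_def)
  let ?f = "\<lambda>v. Poly_Mapping.single (abs_tree (graft \<omega> S' v T')) (1::'k)"
  have "abs_tree (graft \<omega> S v T) = abs_tree (graft \<omega> S' (f v) T')" if "v \<in> verts T" for v
    using tree_iso_graft[OF S T that] by (rule Quotient3_rel_abs[OF Quotient3_tree])
  then have "(\<Sum>v \<in> verts T. Poly_Mapping.single (abs_tree (graft \<omega> S v T)) (1::'k)) =
      (\<Sum>v \<in> verts T. ?f (f v))"
    by (intro sum.cong) simp_all
  also have "\<dots> = (\<Sum>v \<in> verts T'. ?f v)"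
    using T(3) by (intro sum.reindex_bij_betw) (simp add: is_iso_def)
  finally show "(\<Sum>v \<in> verts T. Poly_Mapping.single (abs_tree (graft \<omega> S v T)) (1::'k)) =
      (\<Sum>v \<in> verts T'. ?f v)" .
qed

definition rhd ::
  "'w::ab_semigroup_mult \<Rightarrow> (('x, 'w) tree \<Rightarrow>\<^sub>0 'k::comm_ring_1) \<Rightarrow> (('x, 'w) tree \<Rightarrow>\<^sub>0 'k)
    \<Rightarrow> (('x, 'w) tree \<Rightarrow>\<^sub>0 'k)"
where
  "rhd \<omega> p q =
     (\<Sum>S \<in> Poly_Mapping.keys p. \<Sum>T \<in> Poly_Mapping.keys q.
        scale (Poly_Mapping.lookup p S * Poly_Mapping.lookup q T) (tree_rhd \<omega> S T))"

locale pre_lie_family_algebra = module scl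
  for scl :: "'k::comm_ring_1 \<Rightarrow> 'a::ab_group_add \<Rightarrow> 'a" +
  fixes tri :: "'w::ab_semigroup_mult \<Rightarrow> 'a \<Rightarrow> 'a \<Rightarrow> 'a"
  assumes linear_left: "module_hom scl scl (\<lambda>x. tri \<omega> x y)"
    and linear_right: "module_hom scl scl (\<lambda>y. tri \<omega> x y)"
    and pre_lie:
      "tri \<alpha> x (tri \<beta> y z) - tri (\<alpha> * \<beta>) (tri \<alpha> x y) z =
       tri \<beta> y (tri \<alpha> x z) - tri (\<beta> * \<alpha>) (tri \<beta> y x) z"

end

theory Submission
  imports Defs
begin

text \<open>
  In \<open>S \<rhd>\<^sub>\<alpha> (T \<rhd>\<^sub>\<beta> U)\<close> the tree \<open>S\<close> is grafted either at a vertex of \<open>T\<close> or at a vertex of \<open>U\<close>. In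
  the first case the edge joining \<open>T\<close> to \<open>U\<close> is below the new one and its type becomes \<open>\<alpha>\<beta>\<close>, so
  these terms add up to \<open>(S \<rhd>\<^sub>\<alpha> T) \<rhd>\<^sub>\<alpha>\<^sub>\<beta> U\<close>. In the second case \<open>S\<close> and \<open>T\<close> are grafted on \<open>U\<close>
  independently, and these terms are symmetric under exchanging \<open>(S, \<alpha>)\<close> and \<open>(T, \<beta>)\<close>.
\<close>

section \<open>Paths towards the root in a grafted tree\<close>

lemma graft_rtrancl_inT:
  "(inT a, x) \<in> (edges (graft \<omega> S v T))\<^sup>* \<longleftrightarrow> (\<exists>b. x = inT b \<and> (a, b) \<in> (edges T)\<^sup>*)"
proof
  assume "(inT a, x) \<in> (edges (graft \<omega> S v T))\<^sup>*"
  then show "\<exists>b. x = inT b \<and> (a, b) \<in> (edges T)\<^sup>*"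
    by induction (auto simp: graft_sel(3) inj_in intro: rtrancl_into_rtrancl)
next
  have "(inT a, inT b) \<in> (edges (graft \<omega> S v T))\<^sup>*" if "(a, b) \<in> (edges T)\<^sup>*" for b
    using that by induction (auto simp: graft_edges intro: rtrancl_into_rtrancl)
  then show "\<exists>b. x = inT b \<and> (a, b) \<in> (edges T)\<^sup>* \<Longrightarrow> (inT a, x) \<in> (edges (graft \<omega> S v T))\<^sup>*"
    by blast
qed

text \<open>The only edge leaving the copy of \<open>S\<close> runs from its root to
  \<open>v\<close>. A path from \<open>a\<close> therefore stays in \<open>S\<close> or climbs to
  \<open>root S\<close>, crosses that edge and continues in \<open>T\<close>. That
  \<open>root S\<close> is reachable from \<open>a\<close> is where \<open>S\<close> being a tree
  enters.\<close>

lemma graft_rtrancl_inS: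
  assumes S: "rooted_tree S" and a: "a \<in> verts S"
  shows "(inS a, x) \<in> (edges (graft \<omega> S v T))\<^sup>* \<longleftrightarrow>
    (\<exists>b. x = inS b \<and> (a, b) \<in> (edges S)\<^sup>*) \<or> (\<exists>b. x = inT b \<and> (v, b) \<in> (edges T)\<^sup>*)"
proof
  assume "(inS a, x) \<in> (edges (graft \<omega> S v T))\<^sup>*"
  then show "(\<exists>b. x = inS b \<and> (a, b) \<in> (edges S)\<^sup>*) \<or> (\<exists>b. x = inT b \<and> (v, b) \<in> (edges T)\<^sup>*)"
    by induction (auto simp: graft_sel(3) inj_in intro: rtrancl_into_rtrancl)
next
  have s: "(inS a, inS b) \<in> (edges (graft \<omega> S v T))\<^sup>*" if "(a, b) \<in> (edges S)\<^sup>*" for b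
    using that by induction (auto simp: graft_edges intro: rtrancl_into_rtrancl)
  have "(a, root S) \<in> (edges S)\<^sup>*"
    using S a by (simp add: rooted_tree_def)
  then have "(inS a, inT v) \<in> (edges (graft \<omega> S v T))\<^sup>*"
    by (rule rtrancl_into_rtrancl[OF s]) (simp add: graft_edges)
  then have "(inS a, inT b) \<in> (edges (graft \<omega> S v T))\<^sup>*" if "(v, b) \<in> (edges T)\<^sup>*" for b
    by (rule rtrancl_trans) (simp add: graft_rtrancl_inT inj_in that)
  with s show "(\<exists>b. x = inS b \<and> (a, b) \<in> (edges S)\<^sup>*) \<or> (\<exists>b. x = inT b \<and> (v, b) \<in> (edges T)\<^sup>*)
      \<Longrightarrow> (inS a, x) \<in> (edges (graft \<omega> S v T))\<^sup>*"
    by blast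
qed

lemma map_prod_in_iff:
  "(inS m, inS n) \<in> map_prod inS inS ` A \<longleftrightarrow> (m, n) \<in> A"
  "(inT m, inT n) \<in> map_prod inT inT ` A \<longleftrightarrow> (m, n) \<in> A"
  "(inT m, x) \<notin> map_prod inS inS ` A"
  "(x, inT m) \<notin> map_prod inS inS ` A"
  "(inS m, x) \<notin> map_prod inT inT ` A"
  "(x, inS m) \<notin> map_prod inT inT ` A"
  by (auto simp: inj_in intro: map_prod_imageI)

text \<open>No edge leads from the copy of \<open>T\<close> into that of \<open>S\<close>, so a
  later grafting at a vertex of \<open>T\<close> leaves the types inside \<open>S\<close> and the
  type of the connecting edge alone.\<close>

lemma edges_below_graft_inT:
  "edges_below (graft \<omega> S v T) (inT u) = map_prod inT inT ` edges_below T u"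
  unfolding edges_below_def graft_rtrancl_inT
  by (auto simp: graft_sel(3) inj_in map_prod_in_iff)

text \<open>The connecting edge and the whole path below \<open>v\<close> lie below every vertex of
  \<open>S\<close>. This is why grafting on the upper tree changes types in the lower one.\<close>

lemma edges_below_graft_inS:
  assumes S: "rooted_tree S" and u: "u \<in> verts S"
  shows "edges_below (graft \<omega> S v T) (inS u) =
    map_prod inS inS ` edges_below S u \<union> map_prod inT inT ` edges_below T v \<union> {(inS (root S), inT v)}"
proof -
  have "(u, root S) \<in> (edges S)\<^sup>*"
    using S u by (simp add: rooted_tree_def)
  then show ?thesis
    unfolding edges_below_def graft_rtrancl_inS[OF S u]
    by (auto simp: graft_sel(3) inj_in map_prod_in_iff)
qed

section \<open>Isomorphisms between iterated graftings\<close>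

lemma tree_iso_graft_commute:
  assumes S: "rooted_tree S" and T: "rooted_tree T" and U: "rooted_tree U"
    and v: "v \<in> verts U" and w: "w \<in> verts U"
  shows "tree_iso (graft \<alpha> S (inT w) (graft \<beta> T v U)) (graft \<beta> T (inT v) (graft \<alpha> S w U))"
    (is "tree_iso ?L ?R")
proof -
  \<comment> \<open>\<open>h\<close> exchanges the codes of \<open>S\<close> and \<open>T\<close>:
    the vertices of \<open>S\<close> are \<open>inS n\<close> in \<open>?L\<close> and
    \<open>inT (inS n)\<close> in \<open>?R\<close>, those of \<open>T\<close> the other way round,
    and those of \<open>U\<close> are \<open>inT (inT n)\<close> in both.\<close>
  define h where "h n = (if even n then inT n
     else if even (n div 2) then n div 2 else n)" for n
  have h: "h (inS n) = inT (inS n)" "h (inT (inS n)) = inS n" "h (inT (inT n)) = inT (inT n)" for n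
    by (simp_all add: h_def parity_in)
  have "is_iso h ?L ?R"
    unfolding is_iso_def
  proof (intro conjI)
    show "bij_betw h (verts ?L) (verts ?R)"
      unfolding bij_betw_def
    proof
      show "inj_on h (verts ?L)"
        by (rule inj_onI) (auto simp: graft_sel(1) h inj_in)
      show "h ` verts ?L = verts ?R"
        by (auto simp add: graft_sel(1) image_Un image_image h)
    qed
    show "h (root ?L) = root ?R" by (simp add: graft_sel h)
    show "\<forall>a \<in> verts ?L. \<forall>b \<in> verts ?L. (a, b) \<in> edges ?L \<longleftrightarrow> (h a, h b) \<in> edges ?R"
      by (auto simp: graft_sel(1,2) h graft_edges inj_in)
    show "\<forall>a \<in> verts ?L. dec ?R (h a) = dec ?L a"
      by (auto simp: graft_sel(1,4,5) h)
    \<comment> \<open>An edge of \<open>U\<close> collects \<alpha> if it is below \<open>w\<close>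
      and \<beta> if it is below \<open>v\<close>. If it is below both, the factors arrive in
      opposite orders on the two sides, and commutativity identifies them.\<close>
    show "\<forall>(a, b) \<in> edges ?L. etype ?R (h a, h b) = etype ?L (a, b)"
      by (auto simp: graft_sel(2,3,6-8) h edges_below_graft_inT map_prod_in_iff ac_simps)
  qed
  then show ?thesis
    using rooted_tree_graft[of S "graft \<beta> T v U"] rooted_tree_graft[of T "graft \<alpha> S w U"]
      rooted_tree_graft[OF S U w] rooted_tree_graft[OF T U v] S T v w
    by (auto simp: tree_iso_def graft_sel(1))
qed

lemma tree_iso_graft_assoc:
  assumes S: "rooted_tree S" and T: "rooted_tree T" and U: "rooted_tree U"
    and v: "v \<in> verts U" and t: "t \<in> verts T"
  shows "tree_iso (graft \<alpha> S (inS t) (graft \<beta> T v U)) (graft (\<alpha> * \<beta>) (graft \<alpha> S t T) v U)"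
    (is "tree_iso ?L ?R")
proof -
  \<comment> \<open>Here \<open>h\<close> rebrackets the disjoint union, from \<open>S\<close>
    beside (\<open>T\<close> beside \<open>U\<close>) to (\<open>S\<close> beside \<open>T\<close>)
    beside \<open>U\<close>.\<close>
  define h where "h n = (if even n then inS n
     else if even (n div 2) then inS (inT (n div 2 div 2)) else n div 2)" for n
  have h: "h (inS n) = inS (inS n)" "h (inT (inS n)) = inS (inT n)" "h (inT (inT n)) = inT n" for n
    by (simp_all add: h_def parity_in)
  have "is_iso h ?L ?R"
    unfolding is_iso_def
  proof (intro conjI)
    show "bij_betw h (verts ?L) (verts ?R)"
      unfolding bij_betw_def
    proof
      show "inj_on h (verts ?L)"
        by (rule inj_onI) (auto simp: graft_sel(1) h inj_in)
      show "h ` verts ?L = verts ?R"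
        by (auto simp add: graft_sel(1) image_Un image_image h)
    qed
    show "h (root ?L) = root ?R" by (simp add: graft_sel h)
    show "\<forall>a \<in> verts ?L. \<forall>b \<in> verts ?L. (a, b) \<in> edges ?L \<longleftrightarrow> (h a, h b) \<in> edges ?R"
      by (auto simp: graft_sel(1,2) h graft_edges inj_in)
    show "\<forall>a \<in> verts ?L. dec ?R (h a) = dec ?L a"
      by (auto simp: graft_sel(1,4,5) h)
    \<comment> \<open>On the left, the edges of \<open>U\<close> below \<open>v\<close> are
      multiplied by \<beta> and then by \<alpha>, on the right by \<alpha>\<beta> at once. The edge
      from \<open>T\<close> to \<open>U\<close> has type \<beta>\<alpha> on the left and
      \<alpha>\<beta> on the right.\<close>
    show "\<forall>(a, b) \<in> edges ?L. etype ?R (h a, h b) = etype ?L (a, b)"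
      by (auto simp: graft_sel(2,3,6-8) h edges_below_graft_inS[OF T t] map_prod_in_iff inj_in ac_simps)
  qed
  then show ?thesis
    using rooted_tree_graft[of S "graft \<beta> T v U"] rooted_tree_graft[of "graft \<alpha> S t T" U]
      rooted_tree_graft[OF S T t] rooted_tree_graft[OF T U v] S U t v
    by (auto simp: tree_iso_def graft_sel(1))
qed

section \<open>The free module and the bilinearity of \<open>rhd\<close>\<close>

lemma lookup_scale: "Poly_Mapping.lookup (scale c p) x = c * Poly_Mapping.lookup p x"
  by (simp add: scale_def Poly_Mapping.map.rep_eq when_def)

lemma scale_add_right: "scale c (p + q) = scale c p + scale c q"
  by (rule poly_mapping_eqI) (simp add: lookup_scale lookup_add distrib_left)

lemma scale_add_left: "scale (c + d) p = scale c p + scale d p"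
  by (rule poly_mapping_eqI) (simp add: lookup_scale lookup_add distrib_right)

lemma scale_scale: "scale c (scale d p) = scale (c * d) p"
  by (rule poly_mapping_eqI) (simp add: lookup_scale mult.assoc)

lemma scale_one: "scale 1 p = p"
  by (rule poly_mapping_eqI) (simp add: lookup_scale)

lemma module_scale: "module (scale :: 'k::comm_ring_1 \<Rightarrow> ('a \<Rightarrow>\<^sub>0 'k) \<Rightarrow> _)"
  by unfold_locales (simp_all add: scale_add_left scale_add_right scale_scale scale_one)

interpretation scale: module "scale :: 'k::comm_ring_1 \<Rightarrow> ('a \<Rightarrow>\<^sub>0 'k) \<Rightarrow> _"
  by (rule module_scale)

text \<open>Keys outside the support contribute zero coefficients. Sums for different arguments can
  thus share one index set, although cancellation may make the support of a sum or a multiple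
  smaller.\<close>

lemma rhd_eq_sum:
  assumes "finite A" "Poly_Mapping.keys p \<subseteq> A" "finite B" "Poly_Mapping.keys q \<subseteq> B"
  shows "rhd \<omega> p q = (\<Sum>S\<in>A. \<Sum>T\<in>B.
    scale (Poly_Mapping.lookup p S * Poly_Mapping.lookup q T) (tree_rhd \<omega> S T))"
proof -
  have "rhd \<omega> p q = (\<Sum>S\<in>Poly_Mapping.keys p. \<Sum>T\<in>B.
    scale (Poly_Mapping.lookup p S * Poly_Mapping.lookup q T) (tree_rhd \<omega> S T))"
    unfolding rhd_def using assms
    by (intro sum.cong refl sum.mono_neutral_left) (auto simp: in_keys_iff)
  also have "\<dots> = (\<Sum>S\<in>A. \<Sum>T\<in>B.
    scale (Poly_Mapping.lookup p S * Poly_Mapping.lookup q T) (tree_rhd \<omega> S T))"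
    using assms by (intro sum.mono_neutral_left) (auto simp: in_keys_iff)
  finally show ?thesis .
qed

lemma rhd_add_left: "rhd \<omega> (p + p') q = rhd \<omega> p q + rhd \<omega> p' q"
proof -
  let ?A = "Poly_Mapping.keys p \<union> Poly_Mapping.keys p'" and ?B = "Poly_Mapping.keys q"
  have "Poly_Mapping.keys (p + p') \<subseteq> ?A" by (rule Poly_Mapping.keys_add)
  then show ?thesis
    by (simp add: rhd_eq_sum[of ?A _ ?B] lookup_add distrib_right scale_add_left sum.distrib)
qed

lemma rhd_add_right: "rhd \<omega> p (q + q') = rhd \<omega> p q + rhd \<omega> p q'"
proof -
  let ?A = "Poly_Mapping.keys p" and ?B = "Poly_Mapping.keys q \<union> Poly_Mapping.keys q'"
  have "Poly_Mapping.keys (q + q') \<subseteq> ?B" by (rule Poly_Mapping.keys_add)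
  then show ?thesis
    by (simp add: rhd_eq_sum[of ?A _ ?B] lookup_add distrib_left scale_add_left sum.distrib)
qed

lemma keys_scale: "Poly_Mapping.keys (scale c p) \<subseteq> Poly_Mapping.keys p"
  by (auto simp: in_keys_iff lookup_scale)

lemma rhd_scale_left: "rhd \<omega> (scale c p) q = scale c (rhd \<omega> p q)"
  by (simp add: rhd_eq_sum[of "Poly_Mapping.keys p" _ "Poly_Mapping.keys q"] keys_scale
      lookup_scale scale.scale_sum_right mult.assoc)

lemma rhd_scale_right: "rhd \<omega> p (scale c q) = scale c (rhd \<omega> p q)"
  by (simp add: rhd_eq_sum[of "Poly_Mapping.keys p" _ "Poly_Mapping.keys q"] keys_scale
      lookup_scale scale.scale_sum_right mult.left_commute)

lemma module_hom_rhd_left: "module_hom scale scale (\<lambda>p. rhd \<omega> p q)"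
  by unfold_locales (simp_all add: rhd_add_left rhd_scale_left)

lemma module_hom_rhd_right: "module_hom scale scale (rhd \<omega> p)"
  by unfold_locales (simp_all add: rhd_add_right rhd_scale_right)

lemmas rhd_sum_left = module_hom.sum[OF module_hom_rhd_left]
  and rhd_sum_right = module_hom.sum[OF module_hom_rhd_right]

section \<open>The identity on single trees\<close>

lemma sum_verts_graft:
  assumes "rooted_tree S" "rooted_tree T"
  shows "(\<Sum>n\<in>verts (graft \<omega> S v T). g n) = (\<Sum>s\<in>verts S. g (inS s)) + (\<Sum>t\<in>verts T. g (inT t))"
proof -
  have "inj_on inS (verts S)" "inj_on inT (verts T)"
    by (auto simp: inj_on_def inj_in)
  then show ?thesis
    unfolding graft_sel(1) using assms
    by (subst sum.union_disjoint) (auto simp: inj_in sum.reindex rooted_tree_def)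
qed

abbreviation basis :: "('x, 'w) typed_graph \<Rightarrow> ('x, 'w) tree \<Rightarrow>\<^sub>0 'k::comm_ring_1" where
  "basis T \<equiv> Poly_Mapping.single (abs_tree T) 1"

lemma rhd_basis:
  assumes "rooted_tree S" "rooted_tree T"
  shows "rhd \<omega> (basis S) (basis T) = (\<Sum>v\<in>verts T. basis (graft \<omega> S v T))"
proof -
  have "tree_iso S S" "tree_iso T T"
    using assms is_iso_id by (auto simp: tree_iso_def)
  then show ?thesis
    by (simp add: rhd_def tree_rhd.abs_eq scale_one)
qed

lemma abs_tree_eqI: "tree_iso S T \<Longrightarrow> abs_tree S = abs_tree T"
  by (rule Quotient3_rel_abs[OF Quotient3_tree])

lemma associator_basis:
  assumes S: "rooted_tree S" and T: "rooted_tree T" and U: "rooted_tree U"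
  shows "rhd \<alpha> (basis S) (rhd \<beta> (basis T) (basis U)) -
      rhd (\<alpha> * \<beta>) (rhd \<alpha> (basis S) (basis T)) (basis U) =
    (\<Sum>v\<in>verts U. \<Sum>w\<in>verts U. basis (graft \<alpha> S (inT w) (graft \<beta> T v U)))"
    (is "?l - ?r = _")
proof -
  have l: "?l = (\<Sum>v\<in>verts U. (\<Sum>t\<in>verts T. basis (graft \<alpha> S (inS t) (graft \<beta> T v U))) +
      (\<Sum>w\<in>verts U. basis (graft \<alpha> S (inT w) (graft \<beta> T v U))))"
    using S T U by (simp add: rhd_basis rhd_sum_right rooted_tree_graft sum_verts_graft)
  have "?r = (\<Sum>t\<in>verts T. \<Sum>v\<in>verts U. basis (graft (\<alpha> * \<beta>) (graft \<alpha> S t T) v U))"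
    using S T U by (simp add: rhd_basis rhd_sum_left rooted_tree_graft)
  also have "\<dots> = (\<Sum>v\<in>verts U. \<Sum>t\<in>verts T. basis (graft \<alpha> S (inS t) (graft \<beta> T v U)))"
    by (subst sum.swap)
      (intro sum.cong refl arg_cong2[of _ _ _ _ Poly_Mapping.single] abs_tree_eqI[symmetric]
        tree_iso_graft_assoc S T U)
  finally show ?thesis
    unfolding l by (simp add: sum.distrib)
qed

lemma pre_lie_basis:
  assumes S: "rooted_tree S" and T: "rooted_tree T" and U: "rooted_tree U"
  shows "rhd \<alpha> (basis S) (rhd \<beta> (basis T) (basis U)) -
      rhd (\<alpha> * \<beta>) (rhd \<alpha> (basis S) (basis T)) (basis U) =
    rhd \<beta> (basis T) (rhd \<alpha> (basis S) (basis U)) -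
      rhd (\<beta> * \<alpha>) (rhd \<beta> (basis T) (basis S)) (basis U)"
  unfolding associator_basis[OF S T U] associator_basis[OF T S U]
  \<comment> \<open>The term for (\<open>v\<close>, \<open>w\<close>) on one side matches the term
    for (\<open>w\<close>, \<open>v\<close>) on the other, hence the exchange of the two
    sums.\<close>
  by (subst sum.swap)
    (intro sum.cong refl arg_cong2[of _ _ _ _ Poly_Mapping.single] abs_tree_eqI
      tree_iso_graft_commute S T U)

section \<open>Extension from trees to the whole module\<close>

lemma tree_cases:
  fixes t :: "('x, 'w) tree"
  obtains T where "rooted_tree T" "t = abs_tree T"
proof -
  \<comment> \<open>In this partial quotient, reflexivity at a representative already says that it
    is a rooted tree.\<close>
  have "tree_iso (rep_tree t) (rep_tree t)" "t = abs_tree (rep_tree t)"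
    using Quotient3_rep_reflp[OF Quotient3_tree, of t]
      Quotient3_abs_rep[OF Quotient3_tree, of t] by auto
  then show ?thesis
    using that by (auto simp: tree_iso_def)
qed

text \<open>A property closed under linear combinations need only be checked on basis elements with
  coefficient one.\<close>

lemma poly_mapping_scale_induct:
  assumes "P 0" "\<And>p q. P p \<Longrightarrow> P q \<Longrightarrow> P (p + q)"
    "\<And>c p. P p \<Longrightarrow> P (scale c p)" "\<And>x. P (Poly_Mapping.single x 1)"
  shows "P p"
proof -
  have p: "p = (\<Sum>x\<in>Poly_Mapping.keys p. scale (Poly_Mapping.lookup p x) (Poly_Mapping.single x 1))"
    by (rule poly_mapping_eqI)
      (auto simp: lookup_sum lookup_scale lookup_single when_def in_keys_iff sum.delta if_distrib cong: if_cong)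
  \<comment> \<open>For infinite \<open>A\<close> the sum is 0 by convention, so \<open>P 0\<close>
    covers that case too.\<close>
  have "P (\<Sum>x\<in>A. scale (Poly_Mapping.lookup p x) (Poly_Mapping.single x 1))" for A
    by (induction A rule: infinite_finite_induct) (auto intro: assms)
  then show ?thesis by (subst p)
qed

theorem proposition3p9:
  shows "pre_lie_family_algebra
    (scale :: 'k::comm_ring_1 \<Rightarrow> (('x, 'w::ab_semigroup_mult) tree \<Rightarrow>\<^sub>0 'k) \<Rightarrow> (('x, 'w) tree \<Rightarrow>\<^sub>0 'k))
    rhd"
proof (intro pre_lie_family_algebra.intro pre_lie_family_algebra_axioms.intro module_scale
    module_hom_rhd_left module_hom_rhd_right)
  note zero = module_hom.zero[OF module_hom_rhd_left] module_hom.zero[OF module_hom_rhd_right]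
  note linear = zero rhd_add_left rhd_add_right rhd_scale_left rhd_scale_right
  fix \<alpha> \<beta> :: 'w and x y z :: "('x, 'w) tree \<Rightarrow>\<^sub>0 'k"
  let ?P = "\<lambda>x y z :: ('x, 'w) tree \<Rightarrow>\<^sub>0 'k. rhd \<alpha> x (rhd \<beta> y z) - rhd (\<alpha> * \<beta>) (rhd \<alpha> x y) z =
    rhd \<beta> y (rhd \<alpha> x z) - rhd (\<beta> * \<alpha>) (rhd \<beta> y x) z"
  \<comment> \<open>This regrouping turns each side of the identity for a sum into a sum of two
    associators, to which the induction hypotheses apply.\<close>
  have add: "a + b - (c + d) = (a - c) + (b - d)" for a b c d :: "('x, 'w) tree \<Rightarrow>\<^sub>0 'k"
    by simp
  show "?P x y z"
  \<comment> \<open>Both sides are linear in each argument, so \<open>x\<close>, \<open>y\<close>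
    and \<open>z\<close> are reduced to basis elements one after another. The zero, sum and scalar
    cases are left to the closing \<open>qed\<close> of each induction.\<close>
  proof (induction x rule: poly_mapping_scale_induct)
    case (4 S)
    show ?case
    proof (induction y rule: poly_mapping_scale_induct)
      case (4 T)
      show ?case
      proof (induction z rule: poly_mapping_scale_induct)
        case (4 U)
        show ?case
          by (cases S rule: tree_cases, cases T rule: tree_cases, cases U rule: tree_cases)
            (simp only: pre_lie_basis)
      qed (simp_all add: linear add flip: scale.scale_right_diff_distrib)
    qed (simp_all add: linear add flip: scale.scale_right_diff_distrib)
  qed (simp_all add: linear add flip: scale.scale_right_diff_distrib)
qed

end
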